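(* Let $A\in\mathbb{R}^{m\times n}$ be of full row rank, $b\in\mathbb{R}^m$, $0<s\le n$, $A_s=\{w\in\mathbb{R}^n:\|w\|_0\le s\}$, and $Q\in\{(AA^{\top})^{-1},I_m\}$, with $f_Q$ and $L_Q$ as in the context. Suppose there exists $\nu_s>0$ such that $$\nu_s\|w\|^2\le\|Aw\|^2,\quad\forall w\in A_s.$$ Then any sequence $\{w^k\}$ generated by $w^{k+1}\in T^\lambda_{\rm PS}(w^k)$ with $\lambda\in(0,1/L_Q)$ has an accumulation point $w^*\in\mathrm{Fix}(T^\lambda_{\rm PS})$, and if $T^\lambda_{\rm PS}$ is single-valued at $w^*$, then $\{w^k\}$ converges to $w^*$ at a local $Q$-linear rate.
   Context: This concerns the sparse affine feasibility problem: find $w\in S_1\cap S_2$ with $S_1=\{w\in\mathbb{R}^n: Aw=b\}$ and $S_2=A_s$, where $\|w\|_0$ is the number of nonzero entries of $w$. $\|\cdot\|$ is the Euclidean norm (operator norm for matrices). $\mathrm{Fix}(T)=\{w:w\in T(w)\}$. $P_{S_2}(w)=\arg\min_{z\in S_2}\|w-z\|$ is the (possibly set-valued) projector. $f_Q(w)=\frac12w^{\top}A^{\top}QAw-w^{\top}A^{\top}Qb+\frac12b^{\top}Qb$, with $\nabla f_Q(w)=A^{\top}Q(Aw-b)$; $L_Q=1$ if $Q=(AA^{\top})^{-1}$ and $L_Q=\|A\|^2$ if $Q=I_m$. The projected subgradient operator is $T^\lambda_{\rm PS}(w)=P_{S_2}(w-\lambda\nabla f_Q(w))$. Convergence at a local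 $Q$-linear rate means there is $\kappa\in[0,1)$ with $\|w^{k+1}-w^*\|\le\kappa\|w^k-w^*\|$ for all sufficiently large $k$. *)

theory Defs
  imports "HOL-Analysis.Analysis"
begin

definition l0_norm :: "real^'n \<Rightarrow> nat" where
  "l0_norm w = card {i. w $ i \<noteq> 0}"

definition sparse_set :: "nat \<Rightarrow> (real^'n) set" where
  "sparse_set s = {w. l0_norm w \<le> s}"

definition projector :: "'a::real_normed_vector set \<Rightarrow> 'a \<Rightarrow> 'a set" where
  "projector S w = {z. is_arg_min (\<lambda>z. norm (w - z)) (\<lambda>z. z \<in> S) z}"

definition Fix :: "('a \<Rightarrow> 'a set) \<Rightarrow> 'a set" where
  "Fix T = {w. w \<in> T w}"

definition f_Q :: "real^'n^'m \<Rightarrow> real^'m \<Rightarrow> real^'m^'m \<Rightarrow> real^'n \<Rightarrow> real" where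
  "f_Q A b Q w = 1/2 * (w \<bullet> (transpose A *v (Q *v (A *v w))))
     - w \<bullet> (transpose A *v (Q *v b)) + 1/2 * (b \<bullet> (Q *v b))"

definition gradient :: "('a::real_inner \<Rightarrow> real) \<Rightarrow> 'a \<Rightarrow> 'a" where
  "gradient f w = (THE g. GDERIV f w :> g)"

lemma gradient_eqI:
  assumes "GDERIV f w :> g"
  shows "gradient f w = g"
  unfolding gradient_def
proof (rule the_equality)
  show "GDERIV f w :> g" by fact
next
  fix h assume "GDERIV f w :> h"
  then have "(f has_derivative (\<lambda>x. x \<bullet> h)) (at w)"
    and "(f has_derivative (\<lambda>x. x \<bullet> g)) (at w)"
    using assms by (simp_all only: gderiv_def)
  then have "(\<lambda>x. x \<bullet> h) = (\<lambda>x. x \<bullet> g)"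
    by (rule has_derivative_unique)
  then have "\<forall>x. x \<bullet> h = x \<bullet> g" by (rule fun_cong[THEN allI])
  then show "h = g" by (simp only: vector_eq_ldot)
qed

lemma gradient_f_Q:
  fixes A :: "real^'n^'m"
  assumes sym: "transpose Q = Q"
  shows "gradient (f_Q A b Q) w = transpose A *v (Q *v (A *v w - b))"
proof (rule gradient_eqI)
  define M where "M x = transpose A *v (Q *v (A *v x))" for x
  define c where "c = transpose A *v (Q *v b)"
  have lin: "linear M"
    unfolding M_def
    by (rule linearI)
       (simp_all add: matrix_vector_right_distrib matrix_vector_mult_scaleR
          del: transpose_matrix_vector)
  then have derM: "(M has_derivative M) (at w)"
    by (simp add: bounded_linear_imp_has_derivative linear_conv_bounded_linear)
  have symQ: "u \<bullet> (Q *v v) = v \<bullet> (Q *v u)" for u v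
    using dot_lmul_matrix[of u Q v] transpose_matrix_vector[of Q u] sym
    by (simp add: inner_commute)
  have innerM: "x \<bullet> M y = (A *v x) \<bullet> (Q *v (A *v y))" for x y
    unfolding M_def transpose_matrix_vector
    by (subst (1 2) inner_commute) (rule dot_lmul_matrix)
  have symM: "x \<bullet> M y = y \<bullet> M x" for x y
    unfolding innerM by (rule symQ)
  have fM: "f_Q A b Q = (\<lambda>w. 1/2 * (w \<bullet> M w) - w \<bullet> c + 1/2 * (b \<bullet> (Q *v b)))"
    unfolding f_Q_def M_def c_def by (rule ext) (rule refl)
  have quad: "((\<lambda>w. w \<bullet> M w) has_derivative (\<lambda>h. w \<bullet> M h + h \<bullet> M w)) (at w)"
    by (rule has_derivative_inner[OF has_derivative_ident derM])
  have "(f_Q A b Q has_derivative (\<lambda>h. 1/2 * (w \<bullet> M h + h \<bullet> M w) - h \<bullet> c + 0)) (at w)"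
    unfolding fM
    by (intro has_derivative_add has_derivative_diff has_derivative_mult_right quad
        has_derivative_inner_left has_derivative_ident has_derivative_const)
  moreover have "1/2 * (w \<bullet> M h + h \<bullet> M w) - h \<bullet> c + 0 = h \<bullet> (M w - c)" for h
    using symM[of w h] by (simp add: inner_diff_right)
  ultimately have "GDERIV (f_Q A b Q) w :> M w - c"
    unfolding gderiv_def by (simp only:)
  moreover have "M w - c = transpose A *v (Q *v (A *v w - b))"
    unfolding M_def c_def
    by (simp add: matrix_vector_mult_diff_distrib del: transpose_matrix_vector)
  ultimately show "GDERIV (f_Q A b Q) w :> transpose A *v (Q *v (A *v w - b))"
    by (rule back_subst)
qed

text \<open>Only the two choices of \<open>Q\<close> tested here are considered.  If they coincide, then
  \<open>A A\<^sup>T = I\<close> and both values are 1.\<close>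

definition L_Q :: "real^'n^'m \<Rightarrow> real^'m^'m \<Rightarrow> real" where
  "L_Q A Q = (if Q = matrix_inv (A ** transpose A) then 1
              else if Q = mat 1 then (onorm ((*v) A))\<^sup>2
              else undefined)"

definition T_PS ::
  "real^'n^'m \<Rightarrow> real^'m \<Rightarrow> real^'m^'m \<Rightarrow> nat \<Rightarrow> real \<Rightarrow> real^'n \<Rightarrow> (real^'n) set" where
  "T_PS A b Q s lam w = projector (sparse_set s) (w - lam *\<^sub>R gradient (f_Q A b Q) w)"

definition accumulation_point :: "(nat \<Rightarrow> 'a::topological_space) \<Rightarrow> 'a \<Rightarrow> bool" where
  "accumulation_point x l \<longleftrightarrow> (\<exists>r. strict_mono r \<and> (x \<circ> r) \<longlonglongrightarrow> l)"

definition converges_locally_Q_linearly ::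
  "(nat \<Rightarrow> 'a::real_normed_vector) \<Rightarrow> 'a \<Rightarrow> bool" where
  "converges_locally_Q_linearly x l \<longleftrightarrow> x \<longlonglongrightarrow> l \<and>
     (\<exists>\<kappa>. 0 \<le> \<kappa> \<and> \<kappa> < 1 \<and>
       (\<forall>\<^sub>F k in sequentially. norm (x (Suc k) - l) \<le> \<kappa> * norm (x k - l)))"

end

theory Submission
  imports Defs
begin

text \<open>
  Every step minimises over the sparse vectors a quadratic majorant of \<open>f\<^sub>Q\<close>, so \<open>f\<^sub>Q\<close> decreases by
  a multiple of the squared step length.  The lower bound \<open>\<nu>\<close> makes \<open>f\<^sub>Q\<close> coercive on the sparse
  vectors; hence the iterates are bounded, the steps tend to zero, and accumulation points are
  fixed points.  Near a fixed point \<open>x\<close> the support of an iterate contains that of \<open>x\<close>, so the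
  difference \<open>w\<^sub>k - x\<close> is itself sparse, and \<open>w\<^sub>k\<^sub>+\<^sub>1 - x\<close> is a restriction of
  \<open>(I - \<lambda> A\<^sup>T Q A) (w\<^sub>k - x)\<close>; this gives a contraction.  Vanishing steps keep the sequence
  inside the neighbourhood where this applies.
\<close>

section \<open>Projection onto sparse vectors\<close>

lemma mem_projector_iff:
  "z \<in> projector S u \<longleftrightarrow> z \<in> S \<and> (\<forall>y\<in>S. norm (u - z) \<le> norm (u - y))"
  unfolding projector_def is_arg_min_def by (auto simp: not_less)

lemma sparse_set_mono:
  assumes "v \<in> sparse_set s" "{i. x $ i \<noteq> 0} \<subseteq> {i. v $ i \<noteq> 0}"
  shows "x \<in> sparse_set s"
  using assms card_mono[OF finite assms(2)] unfolding sparse_set_def l0_norm_def by simp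

text \<open>The radius is the smallest absolute value of a nonzero entry of \<open>x\<close>, capped
  at 1; inserting \<open>1\<close> keeps the minimum defined when \<open>x = 0\<close>.\<close>

lemma support_subset_near:
  fixes x :: "real^'n"
  shows "\<exists>\<delta>>0. \<forall>v. norm (v - x) < \<delta> \<longrightarrow> {i. x $ i \<noteq> 0} \<subseteq> {i. v $ i \<noteq> 0}"
proof (intro exI conjI allI impI)
  let ?M = "insert 1 ((\<lambda>i. \<bar>x $ i\<bar>) ` {i. x $ i \<noteq> 0})"
  show "0 < Min ?M" by (subst Min_gr_iff) auto
  fix v assume v: "norm (v - x) < Min ?M"
  show "{i. x $ i \<noteq> 0} \<subseteq> {i. v $ i \<noteq> 0}"
  proof
    fix i assume i: "i \<in> {i. x $ i \<noteq> 0}"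
    then have "Min ?M \<le> \<bar>x $ i\<bar>" by (intro Min_le) auto
    moreover have "\<bar>(v - x) $ i\<bar> \<le> norm (v - x)" by (rule component_le_norm_cart)
    ultimately have "\<bar>(v - x) $ i\<bar> < \<bar>x $ i\<bar>" using v by linarith
    then show "i \<in> {i. v $ i \<noteq> 0}" by auto
  qed
qed

text \<open>Overwriting entry \<open>j\<close> of \<open>z\<close> by that of \<open>u\<close>
  lowers the squared distance to \<open>u\<close> by exactly \<open>(u $ j - z $ j)^2\<close>, so a
  minimiser for which this change is admissible can gain nothing from it.\<close>

lemma projector_update_component:
  fixes z u :: "real^'n"
  assumes "z \<in> projector S u" "z + axis j (u $ j - z $ j) \<in> S"
  shows "z $ j = u $ j"
proof -
  define a where "a = u - z"
  have "norm a \<le> norm (a - axis j (a $ j))"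
    using assms unfolding mem_projector_iff a_def by (metis diff_diff_eq vector_minus_component)
  then have "a \<bullet> a \<le> (a - axis j (a $ j)) \<bullet> (a - axis j (a $ j))"
    by (simp add: norm_le)
  also have "\<dots> = a \<bullet> a - (a $ j)\<^sup>2"
    by (simp add: inner_diff_left inner_diff_right inner_axis inner_axis' power2_eq_square)
  finally show ?thesis by (simp add: a_def)
qed

text \<open>Overwriting an entry that is already nonzero cannot enlarge the support, so the
  competitor stays sparse.\<close>

lemma projector_sparse_support:
  fixes z u :: "real^'n"
  assumes "z \<in> projector (sparse_set s) u" "z $ j \<noteq> 0"
  shows "z $ j = u $ j"
proof (rule projector_update_component[OF assms(1)])
  have "z \<in> sparse_set s" using assms(1) by (simp add: mem_projector_iff)
  then show "z + axis j (u $ j - z $ j) \<in> sparse_set s"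
    by (rule sparse_set_mono) (use assms(2) in \<open>auto simp: axis_def split: if_splits\<close>)
qed

text \<open>A spare slot lets any single entry be overwritten, even one outside the support.\<close>

lemma projector_sparse_slack:
  fixes z u :: "real^'n"
  assumes "z \<in> projector (sparse_set s) u" "l0_norm z < s"
  shows "z = u"
proof -
  have "z $ j = u $ j" for j
  proof (rule projector_update_component[OF assms(1)])
    let ?y = "z + axis j (u $ j - z $ j)"
    have "{i. ?y $ i \<noteq> 0} \<subseteq> insert j {i. z $ i \<noteq> 0}" by (auto simp: axis_def)
    then have "l0_norm ?y \<le> card (insert j {i. z $ i \<noteq> 0})"
      unfolding l0_norm_def by (intro card_mono) auto
    also have "\<dots> \<le> Suc (l0_norm z)" unfolding l0_norm_def by (rule card_insert_le_m1) auto
    finally show "?y \<in> sparse_set s" using assms(2) by (simp add: sparse_set_def)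
  qed
  then show ?thesis by (simp add: vec_eq_iff)
qed

section \<open>Projected gradient steps for a quadratic\<close>

text \<open>In the application \<open>H\<close> is \<open>A^T Q A\<close> and \<open>c\<close> is
  \<open>A^T Q b\<close>. \<open>H_bound\<close> is cocoercivity of the gradient: it yields positive
  semidefiniteness, smoothness and the contraction estimate. \<open>H_sparse\<close> is strong
  convexity restricted to sparse directions.\<close>

locale sparse_quadratic =
  fixes H :: "real^'n \<Rightarrow> real^'n" and c :: "real^'n" and L \<mu> lam :: real and s :: nat
  assumes linear_H: "linear H"
    and sym_H: "x \<bullet> H y = y \<bullet> H x"
    and H_bound: "(norm (H v))\<^sup>2 \<le> L * (v \<bullet> H v)"
    and H_sparse: "v \<in> sparse_set s \<Longrightarrow> \<mu> * (norm v)\<^sup>2 \<le> v \<bullet> H v"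
    and L_pos: "0 < L" and \<mu>_pos: "0 < \<mu>" and lam_pos: "0 < lam" and lam_L: "lam * L < 1"
begin

definition grad_step :: "real^'n \<Rightarrow> real^'n" where
  "grad_step v = v - lam *\<^sub>R (H v - c)"

text \<open>In the application this is \<open>f_Q\<close> without its constant term.\<close>

definition obj :: "real^'n \<Rightarrow> real" where
  "obj v = 1/2 * (v \<bullet> H v) - v \<bullet> c"

abbreviation step :: "real^'n \<Rightarrow> (real^'n) set" where
  "step v \<equiv> projector (sparse_set s) (grad_step v)"

lemma H_nonneg: "0 \<le> v \<bullet> H v"
  using H_bound[of v] L_pos by (meson order_trans zero_le_mult_iff zero_le_power2 not_less)

text \<open>Cauchy-Schwarz and \<open>H_bound\<close> bound \<open>(v \<bullet> H v)^2\<close> by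
  \<open>L * (norm v)^2 * (v \<bullet> H v)\<close>; one factor cancels unless it is zero.\<close>

lemma H_upper: "v \<bullet> H v \<le> L * (norm v)\<^sup>2"
proof (cases "v \<bullet> H v = 0")
  case True then show ?thesis using L_pos by simp
next
  case False
  have "(v \<bullet> H v)\<^sup>2 \<le> (norm v * norm (H v))\<^sup>2"
    using H_nonneg norm_cauchy_schwarz by (intro power_mono) auto
  also have "\<dots> \<le> (norm v)\<^sup>2 * (L * (v \<bullet> H v))"
    unfolding power_mult_distrib using H_bound by (intro mult_left_mono) auto
  finally have "(v \<bullet> H v) * (v \<bullet> H v) \<le> (L * (norm v)\<^sup>2) * (v \<bullet> H v)"
    by (simp add: power2_eq_square mult_ac)
  then show ?thesis using False H_nonneg[of v] by (simp add: mult_le_cancel_right)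
qed

text \<open>Being sparse, \<open>v\<close> competes with \<open>v'\<close> in the projection;
  comparing the two gives \<open>d \<bullet> g <= -(d \<bullet> d) / (2 * lam)\<close>. The exact
  second-order expansion of \<open>obj\<close> and \<open>H_upper\<close> do the rest.\<close>

lemma obj_descent:
  assumes "v \<in> sparse_set s" "v' \<in> step v"
  shows "(1 / lam - L) / 2 * (norm (v' - v))\<^sup>2 \<le> obj v - obj v'"
proof -
  define d g where "d = v' - v" and "g = H v - c"
  have "norm (grad_step v - v') \<le> norm (grad_step v - v)"
    using assms by (simp add: mem_projector_iff)
  moreover have "grad_step v - v' = - (d + lam *\<^sub>R g)" "grad_step v - v = - (lam *\<^sub>R g)"
    by (simp_all add: grad_step_def d_def g_def)
  ultimately have "norm (d + lam *\<^sub>R g) \<le> norm (lam *\<^sub>R g)"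
    by (metis norm_minus_cancel)
  then have "(d + lam *\<^sub>R g) \<bullet> (d + lam *\<^sub>R g) \<le> (lam *\<^sub>R g) \<bullet> (lam *\<^sub>R g)"
    by (simp only: norm_le)
  then have "d \<bullet> d + 2 * lam * (d \<bullet> g) \<le> 0"
    by (simp add: inner_add_left inner_add_right inner_commute[of g d] distrib_left)
  then have 1: "d \<bullet> g \<le> - (1 / lam) / 2 * (d \<bullet> d)"
    using lam_pos by (simp add: field_simps)
  have v': "v' = v + d" by (simp add: d_def)
  have "obj v' - obj v = d \<bullet> g + 1/2 * (d \<bullet> H d)"
    unfolding obj_def v' g_def linear_add[OF linear_H]
    using sym_H[of v d] by (simp add: inner_add_left inner_add_right inner_diff_right add_divide_distrib)
  moreover have "d \<bullet> H d \<le> L * (d \<bullet> d)" using H_upper[of d] by (simp add: power2_norm_eq_inner)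
  moreover have "(1 / lam - L) / 2 * (norm d)\<^sup>2 = (1 / lam) / 2 * (d \<bullet> d) - L * (d \<bullet> d) / 2"
    unfolding power2_norm_eq_inner by (simp only: left_diff_distrib diff_divide_distrib times_divide_eq_left)
  ultimately show ?thesis using 1 unfolding d_def[symmetric] by linarith
qed

lemma obj_lower:
  assumes "v \<in> sparse_set s"
  shows "\<mu> / 4 * (norm v)\<^sup>2 - (norm c)\<^sup>2 / \<mu> \<le> obj v"
proof -
  \<comment> \<open>The weights make the linear term cost only half of the quadratic term
    \<open>\<mu> / 2 * (norm v)^2\<close>.\<close>
  have "0 \<le> (\<mu> / 2 * norm v - norm c)\<^sup>2 / \<mu>" using \<mu>_pos by simp
  also have "\<dots> = \<mu> / 4 * (norm v)\<^sup>2 - norm v * norm c + (norm c)\<^sup>2 / \<mu>"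
    using \<mu>_pos by (simp add: power2_eq_square field_simps)
  finally have "norm v * norm c \<le> \<mu> / 4 * (norm v)\<^sup>2 + (norm c)\<^sup>2 / \<mu>" by simp
  then show ?thesis
    using H_sparse[OF assms] norm_cauchy_schwarz[of v c] unfolding obj_def by simp
qed

text \<open>On the support of \<open>v'\<close> both \<open>v'\<close> and \<open>x\<close> agree
  with their gradient steps; elsewhere both vanish. Hence \<open>v' - x\<close> is dominated
  entrywise by \<open>d - lam * H d\<close>. As \<open>d\<close> is supported in the support of
  \<open>v\<close>, it is sparse and \<open>H_sparse\<close> applies to it.\<close>

lemma step_contraction:
  assumes x: "x \<in> step x" and v: "v \<in> sparse_set s" and v': "v' \<in> step v"
    and sub: "{i. x $ i \<noteq> 0} \<subseteq> {i. v $ i \<noteq> 0}" and sub': "{i. x $ i \<noteq> 0} \<subseteq> {i. v' $ i \<noteq> 0}"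
  shows "(norm (v' - x))\<^sup>2 \<le> (1 - lam * (2 - lam * L) * \<mu>) * (norm (v - x))\<^sup>2"
proof -
  define d where "d = v - x"
  \<comment> \<open>Either \<open>x\<close> has a spare slot and equals its gradient step, or its
    support has full size \<open>s\<close> and so must coincide with that of
    \<open>v'\<close>.\<close>
  have x_eq: "x $ i = grad_step x $ i" if "v' $ i \<noteq> 0" for i
  proof (cases "l0_norm x < s")
    case True then show ?thesis using projector_sparse_slack[OF x] by simp
  next
    case False
    moreover have "l0_norm v' \<le> s" using v' by (simp add: mem_projector_iff sparse_set_def)
    ultimately have "card {i. v' $ i \<noteq> 0} \<le> card {i. x $ i \<noteq> 0}" by (simp add: l0_norm_def)
    then have "{i. x $ i \<noteq> 0} = {i. v' $ i \<noteq> 0}" by (intro card_seteq sub') auto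
    then show ?thesis using projector_sparse_support[OF x] that by blast
  qed
  have "norm (v' - x) \<le> norm (grad_step v - grad_step x)"
  proof (rule norm_le_componentwise_cart)
    fix i show "norm ((v' - x) $ i) \<le> norm ((grad_step v - grad_step x) $ i)"
    proof (cases "v' $ i = 0")
      case True then have "x $ i = 0" using sub' by auto
      then show ?thesis using True by simp
    next
      case False
      then show ?thesis using x_eq projector_sparse_support[OF v' False] by simp
    qed
  qed
  also have "grad_step v - grad_step x = d - lam *\<^sub>R H d"
    by (simp add: grad_step_def d_def linear_diff[OF linear_H] algebra_simps)
  finally have "(norm (v' - x))\<^sup>2 \<le> (norm (d - lam *\<^sub>R H d))\<^sup>2" by (intro power_mono) auto
  also have "\<dots> = (norm d)\<^sup>2 - 2 * lam * (d \<bullet> H d) + lam\<^sup>2 * (norm (H d))\<^sup>2"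
    unfolding power2_norm_eq_inner
    by (simp add: inner_commute power2_eq_square algebra_simps)
  also have "\<dots> \<le> (norm d)\<^sup>2 - 2 * lam * (d \<bullet> H d) + lam\<^sup>2 * (L * (d \<bullet> H d))"
    by (intro add_left_mono mult_left_mono H_bound) auto
  also have "\<dots> = (norm d)\<^sup>2 - lam * (2 - lam * L) * (d \<bullet> H d)"
    by (simp add: power2_eq_square algebra_simps)
  also have "\<dots> \<le> (norm d)\<^sup>2 - lam * (2 - lam * L) * (\<mu> * (norm d)\<^sup>2)"
  proof -
    have "d \<in> sparse_set s" by (rule sparse_set_mono[OF v]) (use sub in \<open>auto simp: d_def\<close>)
    then show ?thesis using lam_pos lam_L
      by (intro diff_left_mono mult_left_mono H_sparse) auto
  qed
  finally show ?thesis by (simp add: d_def algebra_simps)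
qed

end

section \<open>Convergence of the iterates\<close>

locale sparse_quadratic_iteration = sparse_quadratic H c L \<mu> lam s
  for H :: "real^'n \<Rightarrow> real^'n" and c L \<mu> lam s +
  fixes w :: "nat \<Rightarrow> real^'n"
  assumes w_Suc: "w (Suc k) \<in> step (w k)"
begin

text \<open>The initial point need not be sparse, hence the shift by one.\<close>

lemma w_sparse: "w (Suc k) \<in> sparse_set s"
  using w_Suc[of k] by (simp add: mem_projector_iff)

lemma w_descent:
  "(1 / lam - L) / 2 * (norm (w (Suc (Suc k)) - w (Suc k)))\<^sup>2 \<le> obj (w (Suc k)) - obj (w (Suc (Suc k)))"
  by (intro obj_descent w_sparse w_Suc)

lemma step_const_pos: "0 < (1 / lam - L) / 2"
  using lam_L lam_pos by (simp add: field_simps)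

lemma obj_decseq: "decseq (\<lambda>k. obj (w (Suc k)))"
proof (rule decseq_SucI)
  fix k
  have "0 \<le> (1 / lam - L) / 2 * (norm (w (Suc (Suc k)) - w (Suc k)))\<^sup>2"
    using step_const_pos by simp
  then show "obj (w (Suc (Suc k))) \<le> obj (w (Suc k))" using w_descent[of k] by linarith
qed

text \<open>The values of \<open>obj\<close> decrease and are bounded below, so their decrements
  tend to zero; by \<open>w_descent\<close> these dominate the squared steps.\<close>

lemma steps_tendsto_0: "(\<lambda>k. w (Suc k) - w k) \<longlonglongrightarrow> 0"
proof -
  have "- ((norm c)\<^sup>2 / \<mu>) \<le> obj (w (Suc k))" for k
  proof -
    have "0 \<le> \<mu> / 4 * (norm (w (Suc k)))\<^sup>2" using \<mu>_pos by simp
    then show ?thesis using obj_lower[OF w_sparse[of k]] by linarith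
  qed
  then obtain l where l: "(\<lambda>k. obj (w (Suc k))) \<longlonglongrightarrow> l"
    using decseq_convergent[OF obj_decseq] by blast
  have "(\<lambda>k. (obj (w (Suc k)) - obj (w (Suc (Suc k)))) / ((1 / lam - L) / 2)) \<longlonglongrightarrow>
      (l - l) / ((1 / lam - L) / 2)"
    using step_const_pos by (intro tendsto_intros l LIMSEQ_Suc[OF l]) auto
  then have "(\<lambda>k. (obj (w (Suc k)) - obj (w (Suc (Suc k)))) / ((1 / lam - L) / 2)) \<longlonglongrightarrow> 0" by simp
  moreover have "norm ((norm (w (Suc (Suc k)) - w (Suc k)))\<^sup>2)
      \<le> (obj (w (Suc k)) - obj (w (Suc (Suc k)))) / ((1 / lam - L) / 2)" for k
    using w_descent[of k] by (simp only: real_norm_def abs_power2 pos_le_divide_eq[OF step_const_pos] mult.commute)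
  ultimately have "(\<lambda>k. (norm (w (Suc (Suc k)) - w (Suc k)))\<^sup>2) \<longlonglongrightarrow> 0"
    by (rule Lim_null_comparison[OF always_eventually[OF allI], rotated])
  from tendsto_real_sqrt[OF this]
  have "(\<lambda>k. norm (w (Suc (Suc k)) - w (Suc k))) \<longlonglongrightarrow> 0" by simp
  then have "(\<lambda>k. w (Suc (Suc k)) - w (Suc k)) \<longlonglongrightarrow> 0"
    by (rule tendsto_norm_zero_cancel)
  then show ?thesis by (rule LIMSEQ_imp_Suc)
qed

lemma accumulation_point_exists: "\<exists>x. accumulation_point w x"
proof -
  \<comment> \<open>\<open>M\<close> solves the bound of \<open>obj_lower\<close> for the squared
    norm at the level \<open>obj (w (Suc 0))\<close>.\<close>
  define M where "M = (obj (w (Suc 0)) + (norm c)\<^sup>2 / \<mu>) * 4 / \<mu>"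
  have "norm (w (Suc k)) \<le> sqrt M" for k
  proof (rule real_le_rsqrt)
    have "obj (w (Suc k)) \<le> obj (w (Suc 0))" using obj_decseq by (auto simp: decseq_def)
    then have "\<mu> / 4 * (norm (w (Suc k)))\<^sup>2 \<le> obj (w (Suc 0)) + (norm c)\<^sup>2 / \<mu>"
      using obj_lower[OF w_sparse[of k]] by linarith
    then show "(norm (w (Suc k)))\<^sup>2 \<le> M"
      unfolding M_def by (subst pos_le_divide_eq[OF \<mu>_pos]) (simp add: mult.commute)
  qed
  then have "bounded (range (\<lambda>k. w (Suc k)))" unfolding bounded_iff by blast
  then obtain x r where "strict_mono r" "((\<lambda>k. w (Suc k)) \<circ> r) \<longlonglongrightarrow> x"
    using bounded_imp_convergent_subsequence by blast
  then have "strict_mono (Suc \<circ> r)" "(w \<circ> (Suc \<circ> r)) \<longlonglongrightarrow> x"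
    by (simp_all add: strict_mono_def o_def)
  then show ?thesis unfolding accumulation_point_def by blast
qed

text \<open>The minimality inequality of the projection passes to the limit along the subsequence,
  for each fixed competitor \<open>y\<close>.\<close>

lemma accumulation_point_fixed:
  assumes "accumulation_point w x"
  shows "x \<in> step x"
proof -
  obtain r where r: "strict_mono r" "(\<lambda>k. w (r k)) \<longlonglongrightarrow> x"
    using assms unfolding accumulation_point_def o_def by blast
  \<comment> \<open>Vanishing steps make the successors converge to the same limit.\<close>
  have "(\<lambda>k. w (r k) + (w (Suc (r k)) - w (r k))) \<longlonglongrightarrow> x + 0"
    using LIMSEQ_subseq_LIMSEQ[OF steps_tendsto_0 r(1)] by (intro tendsto_add r(2)) (simp add: o_def)
  then have r': "(\<lambda>k. w (Suc (r k))) \<longlonglongrightarrow> x" by simp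
  have bl: "bounded_linear H" using linear_H by (simp add: linear_conv_bounded_linear)
  have g: "(\<lambda>k. grad_step (w (r k))) \<longlonglongrightarrow> grad_step x"
    unfolding grad_step_def by (intro tendsto_intros r(2) bounded_linear.tendsto[OF bl])
  \<comment> \<open>This replaces closedness of the sparse set: a nearby sparse iterate has a
    support containing that of \<open>x\<close>.\<close>
  obtain \<delta> where \<delta>: "\<delta> > 0" "\<And>v. norm (v - x) < \<delta> \<Longrightarrow> {i. x $ i \<noteq> 0} \<subseteq> {i. v $ i \<noteq> 0}"
    using support_subset_near[of x] by blast
  obtain k where "norm (w (Suc (r k)) - x) < \<delta>"
    using LIMSEQ_D[OF r' \<delta>(1)] by blast
  then have "x \<in> sparse_set s" using sparse_set_mono[OF w_sparse \<delta>(2)] by blast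
  moreover have "norm (grad_step x - x) \<le> norm (grad_step x - y)" if "y \<in> sparse_set s" for y
  proof (rule LIMSEQ_le)
    show "(\<lambda>k. norm (grad_step (w (r k)) - w (Suc (r k)))) \<longlonglongrightarrow> norm (grad_step x - x)"
      by (intro tendsto_intros g r')
    show "(\<lambda>k. norm (grad_step (w (r k)) - y)) \<longlonglongrightarrow> norm (grad_step x - y)"
      by (intro tendsto_intros g)
    show "\<exists>N. \<forall>k\<ge>N. norm (grad_step (w (r k)) - w (Suc (r k))) \<le> norm (grad_step (w (r k)) - y)"
      using w_Suc that by (auto simp: mem_projector_iff)
  qed
  ultimately show ?thesis by (simp add: mem_projector_iff)
qed

text \<open>The contraction needs both \<open>w k\<close> and \<open>w (Suc k)\<close> within
  \<open>\<delta>\<close> of \<open>x\<close>. Small steps secure this for the successor of a point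
  within \<open>\<delta> / 2\<close>, and the contraction then returns it to that smaller
  ball.\<close>

lemma accumulation_point_linear_rate:
  assumes acc: "accumulation_point w x"
  shows "converges_locally_Q_linearly w x"
proof -
  have x: "x \<in> step x" by (rule accumulation_point_fixed[OF acc])
  obtain r where r: "strict_mono r" "(\<lambda>k. w (r k)) \<longlonglongrightarrow> x"
    using acc unfolding accumulation_point_def o_def by blast
  obtain \<delta> where \<delta>: "\<delta> > 0" "\<And>v. norm (v - x) < \<delta> \<Longrightarrow> {i. x $ i \<noteq> 0} \<subseteq> {i. v $ i \<noteq> 0}"
    using support_subset_near[of x] by blast
  \<comment> \<open>The bound is nonnegative whenever a nonzero sparse vector exists; the \<open>max\<close> avoids the case split.\<close>
  define \<kappa> where "\<kappa> = sqrt (max 0 (1 - lam * (2 - lam * L) * \<mu>))"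
  have "0 < lam * (2 - lam * L) * \<mu>" using lam_pos lam_L \<mu>_pos by simp
  then have \<kappa>: "0 \<le> \<kappa>" "\<kappa> < 1" by (auto simp: \<kappa>_def)
  have contr: "norm (w (Suc k) - x) \<le> \<kappa> * norm (w k - x)"
    if "k \<ge> 1" "norm (w k - x) < \<delta>" "norm (w (Suc k) - x) < \<delta>" for k
  proof (rule power2_le_imp_le)
    have "w k \<in> sparse_set s" using w_sparse[of "k - 1"] that(1) by simp
    then have "(norm (w (Suc k) - x))\<^sup>2 \<le> (1 - lam * (2 - lam * L) * \<mu>) * (norm (w k - x))\<^sup>2"
      by (intro step_contraction x w_Suc \<delta>(2) that)
    also have "\<dots> \<le> max 0 (1 - lam * (2 - lam * L) * \<mu>) * (norm (w k - x))\<^sup>2"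
      by (intro mult_right_mono) auto
    finally show "(norm (w (Suc k) - x))\<^sup>2 \<le> (\<kappa> * norm (w k - x))\<^sup>2"
      by (simp add: \<kappa>_def power_mult_distrib)
  qed (use \<kappa> in auto)
  obtain K where K: "\<And>k. k \<ge> K \<Longrightarrow> norm (w (Suc k) - w k) < \<delta> / 2"
    using LIMSEQ_D[OF steps_tendsto_0, of "\<delta> / 2"] \<delta>(1) by auto
  obtain N where N: "\<And>k. k \<ge> N \<Longrightarrow> norm (w (r k) - x) < \<delta> / 2"
    using LIMSEQ_D[OF r(2), of "\<delta> / 2"] \<delta>(1) by auto
  \<comment> \<open>An index on the subsequence beyond which steps are below
    \<open>\<delta> / 2\<close> and iterates are sparse, with \<open>w k0\<close> itself within
    \<open>\<delta> / 2\<close> of \<open>x\<close>; \<open>r n >= n\<close> makes this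
    possible.\<close>
  define k0 where "k0 = r (max N (max K 1))"
  have k0: "k0 \<ge> K" "k0 \<ge> 1" "norm (w k0 - x) < \<delta> / 2"
    using seq_suble[OF r(1), of "max N (max K 1)"] N[of "max N (max K 1)"]
    by (auto simp: k0_def)
  have pre: "norm (w (Suc k) - x) \<le> \<kappa> * norm (w k - x)"
    if "k \<ge> k0" "norm (w k - x) < \<delta> / 2" for k
  proof (rule contr)
    have "norm (w (Suc k) - x) \<le> norm (w (Suc k) - w k) + norm (w k - x)"
      using norm_triangle_ineq[of "w (Suc k) - w k" "w k - x"] by simp
    then show "norm (w (Suc k) - x) < \<delta>" using K[of k] k0 that by simp
  qed (use k0 that \<delta>(1) in auto)
  have near: "norm (w k - x) < \<delta> / 2" if "k \<ge> k0" for k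
    using that
  proof (induction k rule: dec_induct)
    case base show ?case by (rule k0)
  next
    case (step k)
    have "norm (w (Suc k) - x) \<le> \<kappa> * norm (w k - x)" by (rule pre) (use step in auto)
    also have "\<dots> \<le> norm (w k - x)" using \<kappa> by (intro mult_left_le_one_le) auto
    finally show ?case using step by simp
  qed
  then have rate: "norm (w (Suc k) - x) \<le> \<kappa> * norm (w k - x)" if "k \<ge> k0" for k
    using pre that by blast
  \<comment> \<open>Iterating the rate upgrades convergence from the subsequence to the whole
    sequence.\<close>
  have geo: "norm (w (k + k0) - x) \<le> \<kappa> ^ k * norm (w k0 - x)" for k
  proof (induction k)
    case (Suc k)
    have "norm (w (Suc k + k0) - x) \<le> \<kappa> * norm (w (k + k0) - x)" using rate[of "k + k0"] by simp
    also have "\<dots> \<le> \<kappa> * (\<kappa> ^ k * norm (w k0 - x))" using Suc \<kappa> by (intro mult_left_mono)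
    finally show ?case by (simp add: mult_ac)
  qed simp
  have "(\<lambda>k. \<kappa> ^ k * norm (w k0 - x)) \<longlonglongrightarrow> 0"
    using tendsto_mult_left_zero[OF LIMSEQ_realpow_zero[OF \<kappa>]] by simp
  then have "(\<lambda>k. w (k + k0) - x) \<longlonglongrightarrow> 0"
    by (rule Lim_null_comparison[rotated]) (use geo in auto)
  then have "(\<lambda>k. w (k + k0)) \<longlonglongrightarrow> x" by (simp add: LIM_zero_iff)
  then have "w \<longlonglongrightarrow> x" by (rule LIMSEQ_offset)
  then show ?thesis
    unfolding converges_locally_Q_linearly_def eventually_sequentially using \<kappa> rate by blast
qed

end

section \<open>The two weight matrices\<close>

lemma inner_transpose_vector:
  fixes A :: "real^'n^'m"
  shows "x \<bullet> (transpose A *v y) = (A *v x) \<bullet> y"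
  unfolding transpose_matrix_vector by (metis dot_lmul_matrix inner_commute)

text \<open>If \<open>A A^T y = 0\<close> then \<open>(norm (A^T y))^2 = 0\<close>. By surjectivity
  \<open>y = A x\<close> for some \<open>x\<close>, so
  \<open>y \<bullet> y = x \<bullet> A^T y = 0\<close>.\<close>

lemma full_row_rank_gram_invertible:
  fixes A :: "real^'n^'m"
  assumes "rank A = CARD('m)"
  shows "invertible (A ** transpose A)"
proof -
  have "y = 0" if "(A ** transpose A) *v y = 0" for y
  proof -
    have 0: "transpose A *v y = 0"
      using inner_transpose_vector[of "transpose A *v y" A y] that
      by (simp add: matrix_vector_mul_assoc[symmetric])
    have "surj ((*v) A)" using assms full_rank_surjective by blast
    then obtain x where "A *v x = y" by (metis surjD)
    then show ?thesis using inner_transpose_vector[of x A y] 0 by simp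
  qed
  then show ?thesis
    unfolding invertible_left_inverse matrix_left_invertible_ker by blast
qed

text \<open>These facts feed the assumptions of \<open>sparse_quadratic\<close>. For the inverse
  Gram matrix, \<open>A^T Q A\<close> is an orthogonal projection, so the last bound is an equality
  with constant 1.\<close>

lemma weight_matrix:
  fixes A :: "real^'n^'m" and Q :: "real^'m^'m"
  assumes rank: "rank A = CARD('m)"
    and Q: "Q \<in> {matrix_inv (A ** transpose A), mat 1}"
  shows weight_sym: "transpose Q = Q"
    and weight_pos: "\<exists>\<alpha>>0. \<forall>y. \<alpha> * (norm y)\<^sup>2 \<le> y \<bullet> (Q *v y)"
    and weight_bound: "(norm (transpose A *v (Q *v (A *v v))))\<^sup>2
      \<le> L_Q A Q * (v \<bullet> (transpose A *v (Q *v (A *v v))))"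
proof -
  let ?G = "A ** transpose A"
  have "\<exists>B. ?G ** B = mat 1 \<and> B ** ?G = mat 1"
    using full_row_rank_gram_invertible[OF rank] by (simp only: invertible_def)
  then have G: "?G ** matrix_inv ?G = mat 1"
    unfolding matrix_inv_def by (rule someI_ex[THEN conjunct1])
  have symG: "transpose ?G = ?G" by (simp add: matrix_transpose_mul)
  \<comment> \<open>The transposed right inverse of the symmetric \<open>?G\<close> is a left
    inverse, and the two must coincide.\<close>
  have "transpose (matrix_inv ?G) ** ?G = mat 1"
    by (metis G symG matrix_transpose_mul transpose_mat)
  then have inv_sym: "transpose (matrix_inv ?G) = matrix_inv ?G"
    by (metis G matrix_mul_assoc matrix_mul_lid matrix_mul_rid)
  have GQ: "A *v (transpose A *v (matrix_inv ?G *v y)) = y" for y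
    using G by (simp add: matrix_vector_mul_assoc matrix_mul_assoc del: transpose_matrix_vector)
  have inv_form: "(norm (transpose A *v (matrix_inv ?G *v y)))\<^sup>2 = y \<bullet> (matrix_inv ?G *v y)" for y
    using inner_transpose_vector[of "transpose A *v (matrix_inv ?G *v y)" A "matrix_inv ?G *v y"]
    by (simp only: power2_norm_eq_inner GQ)
  have bl: "bounded_linear ((*v) A)" by (rule matrix_vector_mul_bounded_linear)
  show "transpose Q = Q" using Q inv_sym by (auto simp: transpose_mat)
  show "\<exists>\<alpha>>0. \<forall>y. \<alpha> * (norm y)\<^sup>2 \<le> y \<bullet> (Q *v y)"
  proof (cases "Q = mat 1")
    case True
    then show ?thesis by (intro exI[of _ 1]) (simp add: power2_norm_eq_inner)
  next
    case False
    then have Q': "Q = matrix_inv ?G" using Q by simp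
    obtain B where B: "B > 0" "\<And>x. norm (A *v x) \<le> norm x * B"
      using bounded_linear.pos_bounded[OF bl] by blast
    show ?thesis
    \<comment> \<open>Since \<open>y = A (A^T Q y)\<close>, the norm of \<open>y\<close> is at most
      \<open>B\<close> times that of \<open>A^T Q y\<close>, whose square is
      \<open>y \<bullet> Q y\<close> by \<open>inv_form\<close>.\<close>
    proof (intro exI[of _ "1 / B\<^sup>2"] conjI allI)
      fix y
      have "norm y \<le> norm (transpose A *v (Q *v y)) * B"
        using B(2)[of "transpose A *v (Q *v y)"] by (simp only: Q' GQ)
      then have "(norm y)\<^sup>2 \<le> (norm (transpose A *v (Q *v y)) * B)\<^sup>2" by (intro power_mono) auto
      also have "\<dots> = (y \<bullet> (Q *v y)) * B\<^sup>2" by (simp only: power_mult_distrib Q' inv_form)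
      finally show "1 / B\<^sup>2 * (norm y)\<^sup>2 \<le> y \<bullet> (Q *v y)" using B(1) by (simp add: field_simps)
    qed (use B in simp)
  qed
  show "(norm (transpose A *v (Q *v (A *v v))))\<^sup>2
      \<le> L_Q A Q * (v \<bullet> (transpose A *v (Q *v (A *v v))))"
  proof (cases "Q = matrix_inv ?G")
    case True
    then show ?thesis by (simp only: inv_form inner_transpose_vector L_Q_def if_True mult_1 simp_thms order_refl)
  next
    case False
    then have Q': "Q = mat 1" using Q by simp
    define h where "h = transpose A *v (A *v v)"
    \<comment> \<open>Moving \<open>A^T\<close> across the inner product bounds \<open>h\<close>
      through the norm of \<open>A\<close> rather than that of its transpose; a factor
      \<open>norm h\<close> is cancelled afterwards.\<close>
    have *: "norm h * norm h \<le> norm h * (onorm ((*v) A) * norm (A *v v))"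
    proof -
      have "norm h * norm h = (A *v h) \<bullet> (A *v v)"
        using inner_transpose_vector[of h A "A *v v"]
        by (simp only: h_def[symmetric] dot_square_norm power2_eq_square)
      also have "\<dots> \<le> norm (A *v h) * norm (A *v v)" by (rule norm_cauchy_schwarz)
      also have "\<dots> \<le> (onorm ((*v) A) * norm h) * norm (A *v v)"
        by (intro mult_right_mono onorm[OF bl]) auto
      finally show ?thesis by (simp add: mult_ac)
    qed
    have "norm h \<le> onorm ((*v) A) * norm (A *v v)"
      using * onorm_pos_le[OF bl] by (cases "norm h = 0") (auto simp: mult_le_cancel_left)
    then have "(norm h)\<^sup>2 \<le> (onorm ((*v) A) * norm (A *v v))\<^sup>2" by (intro power_mono) auto
    also have "\<dots> = L_Q A Q * (v \<bullet> h)"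
    proof -
      have "L_Q A Q = (onorm ((*v) A))\<^sup>2" using False Q' unfolding L_Q_def by auto
      then show ?thesis
        by (simp only: h_def inner_transpose_vector power_mult_distrib power2_norm_eq_inner[of "A *v v"])
    qed
    finally show ?thesis by (simp only: h_def Q' matrix_vector_mul_lid)
  qed
qed

theorem theorem6p4:
  fixes A :: "real^'n^'m" and b :: "real^'m" and Q :: "real^'m^'m"
    and s :: nat and \<nu> lam :: real and w :: "nat \<Rightarrow> real^'n"
  assumes "rank A = CARD('m)"
    and "0 < s" and "s \<le> CARD('n)"
    and "Q \<in> {matrix_inv (A ** transpose A), mat 1}"
    and "\<nu> > 0"
    and "\<forall>v \<in> sparse_set s. \<nu> * (norm v)\<^sup>2 \<le> (norm (A *v v))\<^sup>2"
    and "lam \<in> {0 <..< 1 / L_Q A Q}"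
    and "\<forall>k. w (Suc k) \<in> T_PS A b Q s lam (w k)"
  shows "(\<exists>w'. accumulation_point w w' \<and> w' \<in> Fix (T_PS A b Q s lam)) \<and>
    (\<forall>w'. accumulation_point w w' \<and> w' \<in> Fix (T_PS A b Q s lam) \<and>
      is_singleton (T_PS A b Q s lam w') \<longrightarrow> converges_locally_Q_linearly w w')"
proof -
  define H where "H v = transpose A *v (Q *v (A *v v))" for v
  define c where "c = transpose A *v (Q *v b)"
  note symQ = weight_sym[OF assms(1,4)]
  obtain \<alpha> where \<alpha>: "\<alpha> > 0" "\<And>y. \<alpha> * (norm y)\<^sup>2 \<le> y \<bullet> (Q *v y)"
    using weight_pos[OF assms(1,4)] by blast
  have form: "x \<bullet> H y = (A *v x) \<bullet> (Q *v (A *v y))" for x y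
    unfolding H_def by (rule inner_transpose_vector)
  have L: "0 < L_Q A Q" "lam * L_Q A Q < 1" "0 < lam"
  proof -
    show "0 < lam" using assms(7) by simp
    moreover have "lam < 1 / L_Q A Q" using assms(7) by simp
    \<comment> \<open>Positivity of \<open>L_Q A Q\<close> comes from the step-size interval being
      nonempty.\<close>
    ultimately have "0 < 1 / L_Q A Q" by (rule less_trans)
    then show "0 < L_Q A Q" by (simp only: zero_less_divide_1_iff)
    then show "lam * L_Q A Q < 1" using assms(7) by (simp add: pos_less_divide_eq)
  qed
  interpret sparse_quadratic H c "L_Q A Q" "\<alpha> * \<nu>" lam s
  proof (rule sparse_quadratic.intro)
    show "linear H" unfolding H_def
      by (rule linearI)
        (simp_all add: matrix_vector_right_distrib matrix_vector_mult_scaleR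
          del: transpose_matrix_vector)
    show "x \<bullet> H y = y \<bullet> H x" for x y
      using inner_transpose_vector[of "A *v x" Q "A *v y"] by (simp only: form symQ inner_commute)
    show "(norm (H v))\<^sup>2 \<le> L_Q A Q * (v \<bullet> H v)" for v
      unfolding H_def by (rule weight_bound[OF assms(1,4)])
    show "\<alpha> * \<nu> * (norm v)\<^sup>2 \<le> v \<bullet> H v" if "v \<in> sparse_set s" for v
    proof -
      have "\<alpha> * (\<nu> * (norm v)\<^sup>2) \<le> \<alpha> * (norm (A *v v))\<^sup>2"
        using \<alpha>(1) assms(6) that by (intro mult_left_mono) auto
      also have "\<dots> \<le> v \<bullet> H v" unfolding form by (rule \<alpha>(2))
      finally show ?thesis by (simp add: mult.assoc)
    qed
  qed (use L \<alpha>(1) assms(5) in auto)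
  have T: "T_PS A b Q s lam v = step v" for v
    unfolding T_PS_def grad_step_def gradient_f_Q[OF symQ] unfolding H_def c_def
    by (simp add: matrix_vector_mult_diff_distrib del: transpose_matrix_vector)
  interpret sparse_quadratic_iteration H c "L_Q A Q" "\<alpha> * \<nu>" lam s w
    by unfold_locales (use assms(8) T in simp)
  show ?thesis
    using accumulation_point_exists accumulation_point_fixed accumulation_point_linear_rate
    by (auto simp: Fix_def T)
qed

end
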